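(* Let $Q$ be a nonempty norm-separable weak$^{*}$ compact convex subset of a dual Banach space $X^{*}$ and let $(S,Q)$ be a nonexpansive and norm-distal dynamical system, where $Q$ carries the weak$^{*}$ topology. Then there is a fixed point of $S$ in $Q$, i.e. a point $x\in Q$ with $sx=x$ for every $s\in S$.
   Context: A dynamical system $(S,Q)$ consists of a semigroup $S$, a topological space $Q$ and a semigroup action $S\times Q\to Q$, $(s,x)\mapsto sx$ (so $(st)x=s(tx)$), such that for each $s\in S$ the map $Q\ni x\mapsto sx\in Q$ is continuous in the topology of $Q$ (here the weak$^{*}$ topology $\sigma(X^{*},X)$). It is nonexpansive if $\|sx-sy\|\le\|x-y\|$ for all $s\in S$, $x,y\in Q$, and norm-distal if for every pair of distinct $x,y\in Q$, $0$ does not belong to the norm closure of $\{sx-sy:s\in S\}$. *)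

theory Defs
  imports "HOL-Analysis.Analysis"
begin

text \<open>
  The dual of a real Banach space \<open>'a\<close> is \<open>'a \<Rightarrow>\<^sub>L real\<close>, with the operator norm. On it the
  strong operator topology (the pullback of the product topology along evaluation) is
  \<open>\<sigma>(X\<^sup>*, X)\<close>, the topology of pointwise convergence on the predual.
\<close>

abbreviation weak_star_topology :: "('a::real_normed_vector \<Rightarrow>\<^sub>L real) topology" where
  "weak_star_topology \<equiv> strong_operator_topology"

text \<open>
  The phase space is \<open>topspace T\<close>; the values of \<open>act s\<close> outside of it are irrelevant.
  Invariance of the phase space under \<open>act s\<close> is part of \<^const>\<open>continuous_map\<close>.
\<close>

definition dynamical_system :: "'q topology \<Rightarrow> ('s::semigroup_mult \<Rightarrow> 'q \<Rightarrow> 'q) \<Rightarrow> bool" where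
  "dynamical_system T act \<longleftrightarrow>
     (\<forall>s. continuous_map T T (act s)) \<and>
     (\<forall>s t. \<forall>x\<in>topspace T. act (s * t) x = act s (act t x))"

definition nonexpansive_action :: "'b::real_normed_vector set \<Rightarrow> ('s \<Rightarrow> 'b \<Rightarrow> 'b) \<Rightarrow> bool" where
  "nonexpansive_action Q act \<longleftrightarrow>
     (\<forall>s. \<forall>x\<in>Q. \<forall>y\<in>Q. norm (act s x - act s y) \<le> norm (x - y))"

definition norm_distal :: "'b::real_normed_vector set \<Rightarrow> ('s \<Rightarrow> 'b \<Rightarrow> 'b) \<Rightarrow> bool" where
  "norm_distal Q act \<longleftrightarrow>
     (\<forall>x\<in>Q. \<forall>y\<in>Q. x \<noteq> y \<longrightarrow> 0 \<notin> closure {act s x - act s y |s. True})"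

end

theory Submission
  imports Defs
begin

text \<open>
  By Zorn's lemma, \<open>Q\<close> contains a minimal nonempty weak-star compact convex invariant set \<open>K\<close>, and
  \<open>K\<close> contains a minimal nonempty weak-star compact invariant set \<open>M\<close>. The
  claim is that \<open>M\<close> is a single point, which is then fixed. The proof has two parts.

  First, the action on \<open>M\<close> is by surjective isometries, and \<open>M\<close> is norm totally bounded.
  Closed dual balls are weak-star closed, so norm separability and the Baire category theorem give
  nonempty weak-star open subsets of \<open>M\<close> of arbitrarily small norm diameter
  (\<open>small_open_set\<close>). By minimality every orbit in \<open>M\<close> enters such a set. Hence, if \<open>x\<close> and \<open>y\<close> can
  be moved simultaneously weak-star close to one point, they can be moved norm close to each other,
  and norm-distality forces \<open>x = y\<close>: on \<open>M\<close>, norm-distality improves to distality in the topological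
  sense (\<open>norm_distal_imp_distal\<close>). Ellis' theory of distal flows now applies: the pointwise
  closure \<open>E\<close> of the action in \<open>M\<^sup>M\<close> is a compact right topological semigroup, distality makes
  the identity the only idempotent, and so each \<open>s\<close> has an inverse in \<open>E\<close>
  (\<open>distal_flow_invertible\<close>). As the norm is weak-star lower semicontinuous, the elements of \<open>E\<close> are
  nonexpansive too. A bijection that is nonexpansive together with its inverse is an isometry. Being
  isometries, the \<open>s\<close> pull an open set of small norm diameter back to open sets of the same small
  diameter; these cover \<open>M\<close>, and finitely many of them suffice.

  The rest is DeMarr's argument. If \<open>M\<close> had two points, the average \<open>u\<close> of a fine finite net of \<open>M\<close>
  would satisfy \<open>M \<subseteq> cball u r\<close> for some \<open>r\<close> below the diameter of \<open>M\<close>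
  (\<open>better_than_diameter_centre\<close>). The set of all \<open>z \<in> K\<close> with \<open>M \<subseteq> cball z r\<close> is weak-star closed,
  convex, contains \<open>u\<close>, and is invariant because every \<open>s\<close> is nonexpansive and maps \<open>M\<close> onto \<open>M\<close>. By
  minimality it is all of \<open>K\<close>, hence it contains \<open>M\<close>, so the diameter of \<open>M\<close> is at most \<open>r\<close>: a
  contradiction.
\<close>

section \<open>Minimal closed sets and idempotents\<close>

text \<open>
  Zorn's lemma, with compactness keeping the intersection of a chain nonempty. The properties \<open>P\<close> that
  matter here are convexity, invariance and closure under multiplication; all three are stable under
  arbitrary nonempty intersections.
\<close>

lemma minimal_closed_subset:
  assumes "compact_space X" "closedin X A" "A \<noteq> {}" "P A"
    and Inter: "\<And>\<C>. \<C> \<noteq> {} \<Longrightarrow> (\<And>B. B \<in> \<C> \<Longrightarrow> P B) \<Longrightarrow> P (\<Inter>\<C>)"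
  obtains M where "closedin X M" "M \<noteq> {}" "P M" "M \<subseteq> A"
    "\<And>N. closedin X N \<Longrightarrow> N \<noteq> {} \<Longrightarrow> P N \<Longrightarrow> N \<subseteq> M \<Longrightarrow> N = M"
proof -
  define \<F> where "\<F> = {B. closedin X B \<and> B \<noteq> {} \<and> P B \<and> B \<subseteq> A}"
  have "\<exists>U\<in>\<F>. \<forall>B\<in>\<C>. U \<subseteq> B" if "\<C> \<in> Chains (relation_of (\<lambda>B C. C \<subseteq> B) \<F>)" for \<C>
  proof (cases "\<C> = {}")
    case True
    then show ?thesis using assms by (auto simp: \<F>_def)
  next
    case False
    have sub: "\<C> \<subseteq> \<F>" and lin: "\<And>B C. B \<in> \<C> \<Longrightarrow> C \<in> \<C> \<Longrightarrow> B \<subseteq> C \<or> C \<subseteq> B"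
      using that by (auto simp: Chains_def relation_of_def)
    have "\<Inter>\<D> \<noteq> {}" if "finite \<D>" "\<D> \<subseteq> \<C>" for \<D>
    proof (cases "\<D> = {}")
      case False
      have "subset.chain \<F> \<D>"
        unfolding subset_chain_def using \<open>\<D> \<subseteq> \<C>\<close> sub lin by (meson subset_iff)
      then have "\<Inter>\<D> \<in> \<D>"
        using Inter_in_chain that False by blast
      then show ?thesis
        using that sub by (auto simp: \<F>_def)
    qed simp
    then have "\<Inter>\<C> \<noteq> {}"
      using \<open>compact_space X\<close>[unfolded compact_space_fip, rule_format, of \<C>] sub
      by (simp add: \<F>_def subset_iff)
    moreover have "closedin X (\<Inter>\<C>)"
      using False sub by (intro closedin_Inter) (auto simp: \<F>_def)
    moreover have "P (\<Inter>\<C>)"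
      using False sub by (intro Inter) (auto simp: \<F>_def)
    moreover have "\<Inter>\<C> \<subseteq> A"
      using False sub by (auto simp: \<F>_def)
    ultimately have "\<Inter>\<C> \<in> \<F>" by (simp add: \<F>_def)
    then show ?thesis by blast
  qed
  moreover have "partial_order_on \<F> (relation_of (\<lambda>B C. C \<subseteq> B) \<F>)"
    by (rule partial_order_on_relation_ofI) auto
  ultimately obtain M where "M \<in> \<F>" and "\<forall>B\<in>\<F>. B \<subseteq> M \<longrightarrow> B = M"
    using predicate_Zorn[of \<F> "\<lambda>B C. C \<subseteq> B"] by blast
  then show thesis
    by (intro that[of M]) (auto simp: \<F>_def)
qed

text \<open>
  The Ellis--Numakura lemma. In a minimal closed subsemigroup \<open>A\<close>, each \<open>p \<in> A\<close> is idempotent: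
  \<open>A p\<close> is a closed subsemigroup of \<open>A\<close>, hence all of \<open>A\<close>, so \<open>p = q p\<close> for some \<open>q\<close>; then the elements
  \<open>q \<in> A\<close> with \<open>q p = p\<close> form a nonempty closed subsemigroup, hence all of \<open>A\<close>, and \<open>p\<close> is one of them.
\<close>

lemma compact_right_topological_semigroup_idempotent:
  assumes comp: "compact_space Y" and haus: "Hausdorff_space Y" and ne: "topspace Y \<noteq> {}"
    and cont: "\<And>f. f \<in> topspace Y \<Longrightarrow> continuous_map Y Y (\<lambda>g. m g f)"
    and assoc: "\<And>f g h. f \<in> topspace Y \<Longrightarrow> g \<in> topspace Y \<Longrightarrow> h \<in> topspace Y \<Longrightarrow>
        m (m f g) h = m f (m g h)"
  obtains p where "p \<in> topspace Y" "m p p = p"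
proof -
  define P where "P B \<longleftrightarrow> (\<forall>f\<in>B. \<forall>g\<in>B. m f g \<in> B)" for B
  have "P (topspace Y)"
    using cont by (auto simp: P_def continuous_map_def)
  obtain A where A: "closedin Y A" "A \<noteq> {}" "P A"
    and min: "\<And>N. closedin Y N \<Longrightarrow> N \<noteq> {} \<Longrightarrow> P N \<Longrightarrow> N \<subseteq> A \<Longrightarrow> N = A"
    proof (rule minimal_closed_subset[OF comp closedin_topspace ne])
    show "P (\<Inter>\<C>)" if "\<C> \<noteq> {}" "\<And>B. B \<in> \<C> \<Longrightarrow> P B" for \<C>
      using that unfolding P_def by blast
  qed (use \<open>P (topspace Y)\<close> in auto)
  obtain p where "p \<in> A" using A by blast
  have sub: "A \<subseteq> topspace Y" using A closedin_subset by blast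
  have mA: "\<And>f g. f \<in> A \<Longrightarrow> g \<in> A \<Longrightarrow> m f g \<in> A" using A by (auto simp: P_def)
  have cp: "continuous_map Y Y (\<lambda>g. m g p)" using cont \<open>p \<in> A\<close> sub by blast
  have "(\<lambda>g. m g p) ` A = A"
  proof (rule min)
    have "compactin Y ((\<lambda>g. m g p) ` A)"
      using image_compactin[OF _ cp] A comp closedin_compact_space by blast
    then show "closedin Y ((\<lambda>g. m g p) ` A)"
      using haus compactin_imp_closedin by blast
    show "P ((\<lambda>g. m g p) ` A)"
      unfolding P_def
    proof clarify
      fix f g assume "f \<in> A" "g \<in> A"
      then have "m (m f p) (m g p) = m (m (m f p) g) p"
        using assoc mA \<open>p \<in> A\<close> sub by (simp add: subset_iff)
      then show "m (m f p) (m g p) \<in> (\<lambda>g. m g p) ` A"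
        using mA \<open>f \<in> A\<close> \<open>g \<in> A\<close> \<open>p \<in> A\<close> by blast
    qed
    show "(\<lambda>g. m g p) ` A \<noteq> {}" using \<open>p \<in> A\<close> by blast
    show "(\<lambda>g. m g p) ` A \<subseteq> A" using mA \<open>p \<in> A\<close> by blast
  qed
  then have "p \<in> (\<lambda>g. m g p) ` A" using \<open>p \<in> A\<close> by simp
  then obtain q where "q \<in> A" "m q p = p" by (metis imageE)
  have "p \<in> topspace Y" using \<open>p \<in> A\<close> sub by blast
  define B where "B = A \<inter> {g \<in> topspace Y. m g p \<in> {p}}"
  have "closedin Y {p}"
    using haus \<open>p \<in> topspace Y\<close> by (simp add: closedin_Hausdorff_sing_eq)
  then have "closedin Y B"
    unfolding B_def by (intro closedin_Int A(1) closedin_continuous_map_preimage[OF cp])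
  moreover have "P B"
    unfolding P_def
  proof (intro ballI)
    fix f g assume fg: "f \<in> B" "g \<in> B"
    then have "f \<in> A" "g \<in> A" "m f p = p" "m g p = p" by (simp_all add: B_def)
    moreover from this have "m f g \<in> A" "m (m f g) p = m f (m g p)"
      using mA assoc[of f g p] sub \<open>p \<in> topspace Y\<close> by (simp_all add: subset_iff)
    ultimately show "m f g \<in> B" using sub by (auto simp: B_def)
  qed
  ultimately have "B = A"
    using min[of B] \<open>q \<in> A\<close> \<open>m q p = p\<close> sub by (auto simp: B_def)
  then show thesis
    using that \<open>p \<in> A\<close> sub by (auto simp: B_def)
qed

section \<open>The enveloping semigroup of a distal flow\<close>

text \<open>
  The closure is taken in \<open>M\<^sup>M\<close> for \<open>M = topspace X\<close>, with functions made \<^const>\<open>undefined\<close> outside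
  \<open>M\<close>; the matching composition is \<^const>\<open>compose\<close>.
\<close>

definition enveloping_semigroup :: "'q topology \<Rightarrow> ('s \<Rightarrow> 'q \<Rightarrow> 'q) \<Rightarrow> ('q \<Rightarrow> 'q) set" where
  "enveloping_semigroup X act =
     product_topology (\<lambda>_. X) (topspace X) closure_of range (\<lambda>s. restrict (act s) (topspace X))"

definition pair_orbit_closure :: "'q topology \<Rightarrow> ('s \<Rightarrow> 'q \<Rightarrow> 'q) \<Rightarrow> 'q \<Rightarrow> 'q \<Rightarrow> ('q \<times> 'q) set" where
  "pair_orbit_closure X act x y = prod_topology X X closure_of range (\<lambda>s. (act s x, act s y))"

lemma enveloping_semigroup_PiE:
  "f \<in> enveloping_semigroup X act \<Longrightarrow> f \<in> topspace X \<rightarrow>\<^sub>E topspace X"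
  unfolding enveloping_semigroup_def
  using closure_of_subset_topspace[of "product_topology (\<lambda>_. X) (topspace X)"] by fastforce

text \<open>
  Only pairs of points are ever observed, so this projection to \<open>M \<times> M\<close> is the way in which facts
  about the action are passed on to its pointwise limits.
\<close>

lemma enveloping_semigroup_pair:
  assumes "f \<in> enveloping_semigroup X act" "x \<in> topspace X" "y \<in> topspace X"
  shows "(f x, f y) \<in> pair_orbit_closure X act x y"
proof -
  let ?Y = "product_topology (\<lambda>_. X) (topspace X)"
  have "continuous_map ?Y (prod_topology X X) (\<lambda>f. (f x, f y))"
    using assms by (intro continuous_map_pairedI continuous_map_product_projection)
  then have "(f x, f y) \<in> prod_topology X X closure_of
      (\<lambda>f. (f x, f y)) ` range (\<lambda>s. restrict (act s) (topspace X))"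
    using assms(1) continuous_map_image_closure_subset
    unfolding enveloping_semigroup_def by fastforce
  also have "(\<lambda>f. (f x, f y)) ` range (\<lambda>s. restrict (act s) (topspace X)) =
      range (\<lambda>s. (act s x, act s y))"
    using assms by (auto simp: image_image)
  finally show ?thesis by (simp add: pair_orbit_closure_def)
qed

lemma continuous_map_compose_right:
  assumes "f \<in> I \<rightarrow> I"
  shows "continuous_map (product_topology (\<lambda>_. X) I) (product_topology (\<lambda>_. X) I) (\<lambda>g. compose I g f)"
  using assms
  by (auto simp: continuous_map_componentwise compose_def Pi_iff
      intro: continuous_map_product_projection)

lemma continuous_map_compose_left:
  assumes "continuous_map X X h"
  shows "continuous_map (product_topology (\<lambda>_. X) I) (product_topology (\<lambda>_. X) I) (\<lambda>g. compose I h g)"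
proof -
  have "continuous_map (product_topology (\<lambda>_. X) I) X (\<lambda>g. compose I h g k)" if "k \<in> I" for k
  proof -
    have "continuous_map (product_topology (\<lambda>_. X) I) X (h \<circ> (\<lambda>g. g k))"
      using continuous_map_compose[OF continuous_map_product_projection[OF that] assms] by simp
    then show ?thesis by (simp add: compose_def o_def that)
  qed
  then show ?thesis
    by (auto simp: continuous_map_componentwise compose_def)
qed

lemma enveloping_semigroup_act_compose:
  assumes "dynamical_system X act" "f \<in> enveloping_semigroup X act"
  shows "compose (topspace X) (act s) f \<in> enveloping_semigroup X act"
proof -
  let ?Y = "product_topology (\<lambda>_. X) (topspace X)" and ?G = "range (\<lambda>s. restrict (act s) (topspace X))"
  have "continuous_map ?Y ?Y (\<lambda>g. compose (topspace X) (act s) g)"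
    using assms by (intro continuous_map_compose_left) (auto simp: dynamical_system_def)
  then have "compose (topspace X) (act s) f \<in> ?Y closure_of (\<lambda>g. compose (topspace X) (act s) g) ` ?G"
    using assms(2) continuous_map_image_closure_subset unfolding enveloping_semigroup_def by fastforce
  moreover have "compose (topspace X) (act s) (restrict (act t) (topspace X)) =
      restrict (act (s * t)) (topspace X)" for t
    using assms(1) by (auto simp: compose_def dynamical_system_def)
  then have "(\<lambda>g. compose (topspace X) (act s) g) ` ?G \<subseteq> ?G" by auto
  ultimately show ?thesis
    unfolding enveloping_semigroup_def using closure_of_mono by blast
qed

text \<open>
  Composition is continuous in its left argument only, hence the two-step closure argument: the
  acting maps \<open>s\<close> are continuous, so \<open>s \<circ> f\<close> stays in the closure; then \<open>g \<circ> f\<close> follows by letting \<open>s\<close>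
  tend to \<open>g\<close>.
\<close>

lemma enveloping_semigroup_compose:
  assumes "dynamical_system X act" "g \<in> enveloping_semigroup X act" "f \<in> enveloping_semigroup X act"
  shows "compose (topspace X) g f \<in> enveloping_semigroup X act"
proof -
  let ?Y = "product_topology (\<lambda>_. X) (topspace X)" and ?G = "range (\<lambda>s. restrict (act s) (topspace X))"
  have f: "f \<in> topspace X \<rightarrow> topspace X" using enveloping_semigroup_PiE assms(3) by blast
  then have "continuous_map ?Y ?Y (\<lambda>g. compose (topspace X) g f)"
    by (rule continuous_map_compose_right)
  then have *: "compose (topspace X) g f \<in> ?Y closure_of (\<lambda>g. compose (topspace X) g f) ` ?G"
    using assms(2) continuous_map_image_closure_subset unfolding enveloping_semigroup_def by fastforce
  have "compose (topspace X) (restrict (act s) (topspace X)) f = compose (topspace X) (act s) f" for s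
    using f by (auto simp: compose_def restrict_def Pi_iff)
  then have "(\<lambda>g. compose (topspace X) g f) ` ?G \<subseteq> enveloping_semigroup X act"
    using enveloping_semigroup_act_compose[OF assms(1,3)] by auto
  then have "?Y closure_of (\<lambda>g. compose (topspace X) g f) ` ?G \<subseteq> enveloping_semigroup X act"
    by (intro closure_of_minimal) (auto simp: enveloping_semigroup_def)
  then show ?thesis using * by blast
qed

text \<open>
  For \<open>E\<close> the enveloping semigroup, \<open>s \<circ> E\<close> is a compact subsemigroup, so it contains an idempotent \<open>p\<close>.
  Since \<open>p\<close> sends \<open>x\<close> and \<open>p x\<close> to the same point, distality yields \<open>p x = x\<close>. Thus the identity has the
  form \<open>s \<circ> f\<close> with \<open>f \<in> E\<close>. Distality also makes \<open>s\<close> injective, so \<open>f\<close> is a two-sided inverse.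
\<close>

lemma distal_flow_invertible:
  assumes dyn: "dynamical_system X act" and comp: "compact_space X" and haus: "Hausdorff_space X"
    and distal: "\<And>x y w. x \<in> topspace X \<Longrightarrow> y \<in> topspace X \<Longrightarrow>
        (w, w) \<in> pair_orbit_closure X act x y \<Longrightarrow> x = y"
  obtains f where "f \<in> enveloping_semigroup X act"
    "\<And>x. x \<in> topspace X \<Longrightarrow> act s (f x) = x" "\<And>x. x \<in> topspace X \<Longrightarrow> f (act s x) = x"
proof -
  let ?M = "topspace X"
  let ?Y = "product_topology (\<lambda>_. X) ?M"
  let ?E = "enveloping_semigroup X act"
  define A where "A = (\<lambda>f. compose ?M (act s) f) ` ?E"
  have act: "act t x \<in> ?M" if "x \<in> ?M" for t x
    using dyn that by (auto simp: dynamical_system_def continuous_map_def)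
  have GE: "range (\<lambda>s. restrict (act s) ?M) \<subseteq> ?E"
    unfolding enveloping_semigroup_def by (rule closure_of_subset) (auto simp: act)
  have haus': "Hausdorff_space ?Y"
    using haus by (simp add: Hausdorff_space_product_topology)
  have comp': "compact_space ?Y"
    using comp by (simp add: compact_space_product_topology)
  have AE: "A \<subseteq> ?E"
    using enveloping_semigroup_act_compose[OF dyn] by (auto simp: A_def)
  have "closedin ?Y ?E" by (simp add: enveloping_semigroup_def)
  then have "compactin ?Y ?E" using closedin_compact_space comp' by blast
  moreover have "continuous_map ?Y ?Y (compose ?M (act s))"
    using dyn by (intro continuous_map_compose_left) (auto simp: dynamical_system_def)
  ultimately have cA: "compactin ?Y A"
    unfolding A_def by (rule image_compactin)
  have maps: "f \<in> ?M \<rightarrow> ?M" if "f \<in> A" for f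
    using that AE enveloping_semigroup_PiE by blast
  have top: "topspace (subtopology ?Y A) = A"
    using cA compactin_subset_topspace by fastforce
  have mult: "compose ?M g f \<in> A" if "g \<in> A" "f \<in> A" for f g
  proof -
    obtain h where h: "h \<in> ?E" "g = compose ?M (act s) h" using \<open>g \<in> A\<close> by (auto simp: A_def)
    have "compose ?M g f = compose ?M (act s) (compose ?M h f)"
      unfolding h(2) by (rule compose_assoc[OF maps[OF \<open>f \<in> A\<close>], symmetric])
    moreover have "compose ?M h f \<in> ?E"
      using enveloping_semigroup_compose[OF dyn] h that AE by blast
    ultimately show ?thesis by (auto simp: A_def)
  qed
  obtain p where "p \<in> topspace (subtopology ?Y A)" "compose ?M p p = p"
  proof (rule compact_right_topological_semigroup_idempotent)
    show "compact_space (subtopology ?Y A)" using cA compact_space_subtopology by blast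
    show "Hausdorff_space (subtopology ?Y A)" using haus' Hausdorff_space_subtopology by blast
    show "topspace (subtopology ?Y A) \<noteq> {}"
      unfolding top using GE by (auto simp: A_def)
    show "continuous_map (subtopology ?Y A) (subtopology ?Y A) (\<lambda>g. compose ?M g f)"
      if "f \<in> topspace (subtopology ?Y A)" for f
      using that mult maps unfolding top continuous_map_in_subtopology
      by (auto intro!: continuous_map_from_subtopology continuous_map_compose_right)
    show "compose ?M (compose ?M f g) h = compose ?M f (compose ?M g h)"
      if "h \<in> topspace (subtopology ?Y A)" for f g h
      using that unfolding top by (intro compose_assoc[OF maps, symmetric])
  qed
  then have p: "p \<in> A" unfolding top by blast
  have pp: "p (p x) = p x" if "x \<in> ?M" for x
    using compose_eq[of x ?M p p] that \<open>compose ?M p p = p\<close> by simp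
  have p_id: "p x = x" if "x \<in> ?M" for x
  proof -
    have "p x \<in> ?M" using maps[OF p] that by blast
    then show ?thesis
      using distal[of "p x" x "p x"] enveloping_semigroup_pair[of p X act "p x" x] p AE pp that by auto
  qed
  obtain f where f: "f \<in> ?E" "p = compose ?M (act s) f" using p by (auto simp: A_def)
  have sf: "act s (f x) = x" if "x \<in> ?M" for x
    using p_id[OF that] that by (simp add: f(2) compose_def)
  have inj: "x = y" if "x \<in> ?M" "y \<in> ?M" "act s x = act s y" for x y
  proof -
    have "restrict (act s) ?M \<in> ?E" using GE by blast
    from enveloping_semigroup_pair[OF this that(1,2)] show ?thesis
      using distal that by simp
  qed
  have "f (act s x) = x" if "x \<in> ?M" for x
    using inj[of "f (act s x)" x] sf[OF act[OF that]] that act enveloping_semigroup_PiE[OF f(1)] by blast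
  then show thesis using that f(1) sf by blast
qed


section \<open>Topologies for which the norm is lower semicontinuous\<close>

text \<open>
  Lower semicontinuity of \<open>(u, v) \<mapsto> norm (u - v)\<close> is the only link between the norm and the
  weak-star topology on which the dynamical part of the argument relies.
\<close>

definition norm_lsc :: "'b::real_normed_vector topology \<Rightarrow> bool" where
  "norm_lsc X \<longleftrightarrow>
     (\<forall>c. closedin (prod_topology X X) {(u, v) \<in> topspace X \<times> topspace X. norm (u - v) \<le> c})"

lemma norm_lsc_subtopology:
  assumes "norm_lsc X"
  shows "norm_lsc (subtopology X M)"
  unfolding norm_lsc_def
proof
  fix c
  have "{(u, v) \<in> topspace (subtopology X M) \<times> topspace (subtopology X M). norm (u - v) \<le> c} =
      {(u, v) \<in> topspace X \<times> topspace X. norm (u - v) \<le> c} \<inter> (M \<times> M)"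
    by auto
  then show "closedin (prod_topology (subtopology X M) (subtopology X M))
      {(u, v) \<in> topspace (subtopology X M) \<times> topspace (subtopology X M). norm (u - v) \<le> c}"
    using assms unfolding norm_lsc_def subtopology_Times [symmetric] closedin_subtopology by blast
qed

lemma norm_lsc_closed_ball:
  assumes "norm_lsc X" "y \<in> topspace X"
  shows "closedin X {x \<in> topspace X. norm (x - y) \<le> c}"
proof -
  have "continuous_map X (prod_topology X X) (\<lambda>x. (x, y))"
    using assms(2) by (intro continuous_map_pairedI) auto
  from closedin_continuous_map_preimage[OF this] assms show ?thesis
    unfolding norm_lsc_def by (smt (verit) Collect_cong case_prodI mem_Collect_eq case_prodD mem_Sigma_iff)
qed

lemma weak_star_Hausdorff: "Hausdorff_space weak_star_topology"
proof (rule Hausdorff_space_injective_preimage)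
  show "Hausdorff_space (euclidean :: ('a \<Rightarrow> real) topology)"
    unfolding euclidean_product_topology [symmetric] by (simp add: Hausdorff_space_product_topology)
  show "continuous_map weak_star_topology euclidean (blinfun_apply :: ('a \<Rightarrow>\<^sub>L real) \<Rightarrow> _)"
    using continuous_map_pullback[of euclidean euclidean id UNIV blinfun_apply]
    by (simp add: strong_operator_topology_def)
qed (auto simp: inj_on_def blinfun_apply_inject)

text \<open>The condition \<open>norm (u - v) \<le> c\<close> is the conjunction over all \<open>a\<close> of the weak-star closed
  conditions \<open>\<bar>u a - v a\<bar> \<le> c * norm a\<close>.\<close>

lemma weak_star_norm_lsc: "norm_lsc weak_star_topology"
  unfolding norm_lsc_def
proof
  fix c :: real
  let ?W = "weak_star_topology :: ('a \<Rightarrow>\<^sub>L real) topology"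
  let ?R = "{(u, v) \<in> topspace ?W \<times> topspace ?W. norm (u - v) \<le> c}"
  show "closedin (prod_topology ?W ?W) ?R"
  proof (cases "c \<ge> 0")
    case False
    then have "?R = {}" using norm_ge_zero order_trans by blast
    then show ?thesis by (metis closedin_empty)
  next
    case True
    define g where "g a p = blinfun_apply (fst p) a - blinfun_apply (snd p) a"
      for a and p :: "('a \<Rightarrow>\<^sub>L real) \<times> ('a \<Rightarrow>\<^sub>L real)"
    have ev: "continuous_map ?W euclidean (\<lambda>u. blinfun_apply u a)" for a
      by (rule strong_operator_topology_continuous_evaluation)
    have "continuous_map (prod_topology ?W ?W) euclidean (g a)" for a
      unfolding g_def
      using continuous_map_compose[OF continuous_map_fst ev] continuous_map_compose[OF continuous_map_snd ev]
      by (intro continuous_map_diff) (simp_all add: o_def)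
    then have "closedin (prod_topology ?W ?W)
        {p \<in> topspace (prod_topology ?W ?W). g a p \<in> {- (c * norm a)..c * norm a}}" for a
      by (rule closedin_continuous_map_preimage) auto
    then have "closedin (prod_topology ?W ?W)
        (\<Inter>a. {p \<in> topspace (prod_topology ?W ?W). g a p \<in> {- (c * norm a)..c * norm a}})"
      by (intro closedin_Inter) auto
    also have "(\<Inter>a. {p \<in> topspace (prod_topology ?W ?W). g a p \<in> {- (c * norm a)..c * norm a}}) = ?R"
    proof -
      have "norm (u - v) \<le> c \<longleftrightarrow> (\<forall>a. g a (u, v) \<in> {- (c * norm a)..c * norm a})" for u v
      proof
        assume "norm (u - v) \<le> c"
        show "\<forall>a. g a (u, v) \<in> {- (c * norm a)..c * norm a}"
        proof
          fix a
          have "\<bar>blinfun_apply (u - v) a\<bar> \<le> norm (u - v) * norm a"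
            using norm_blinfun[of "u - v" a] by simp
          also have "\<dots> \<le> c * norm a"
            using \<open>norm (u - v) \<le> c\<close> by (simp add: mult_right_mono)
          finally show "g a (u, v) \<in> {- (c * norm a)..c * norm a}"
            by (simp add: g_def blinfun.diff_left abs_le_iff)
        qed
      next
        assume "\<forall>a. g a (u, v) \<in> {- (c * norm a)..c * norm a}"
        then have "norm (blinfun_apply (u - v) a) \<le> c * norm a" for a
          by (simp add: g_def blinfun.diff_left abs_le_iff) (smt (verit))
        then show "norm (u - v) \<le> c" by (rule norm_blinfun_bound[OF True])
      qed
      then show ?thesis by (auto simp: strong_operator_topology_topspace)
    qed
    finally show ?thesis .
  qed
qed

text \<open>
  A countable dense subset of \<open>Q\<close> may miss \<open>M\<close> altogether, so its elements are replaced by nearby points of \<open>M\<close>.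
\<close>

lemma separable_countable_net:
  fixes Q :: "'b::real_normed_vector set"
  assumes "separable_space (subtopology euclidean Q)" "M \<subseteq> Q" "e > 0"
  obtains D where "countable D" "D \<subseteq> M" "\<And>x. x \<in> M \<Longrightarrow> \<exists>d\<in>D. norm (x - d) \<le> e"
proof -
  obtain C where C: "countable C" "C \<subseteq> Q" "subtopology euclidean Q closure_of C = Q"
    using assms(1) by (auto simp: separable_space_def)
  have near: "\<exists>q\<in>C. norm (x - q) < e / 2" if "x \<in> M" for x
  proof -
    have "x \<in> closure C"
      using that assms(2) C by (auto simp: closure_of_subtopology Int_absorb1)
    then show ?thesis
      using \<open>e > 0\<close> unfolding closure_approachable by (metis half_gt_zero dist_norm norm_minus_commute)
  qed
  define P where "P q m \<longleftrightarrow> m \<in> M \<and> norm (m - q) < e / 2" for q m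
  define c where "c q = (SOME m. P q m)" for q
  define C' where "C' = {q \<in> C. \<exists>m. P q m}"
  have c: "P q (c q)" if "q \<in> C'" for q
    using that by (auto simp: C'_def c_def intro: someI_ex)
  show thesis
  proof
    show "countable (c ` C')" using C by (simp add: C'_def)
    show "c ` C' \<subseteq> M" using c by (auto simp: P_def)
    fix x assume "x \<in> M"
    then obtain q where "q \<in> C" and xq: "norm (x - q) < e / 2" using near by blast
    then have q: "q \<in> C'" using \<open>x \<in> M\<close> by (auto simp: C'_def P_def)
    then have "norm (x - c q) \<le> e"
      using c[OF q] xq norm_triangle_ineq4[of "x - q" "c q - q"] by (simp add: P_def)
    then show "\<exists>d\<in>c ` C'. norm (x - d) \<le> e" using q by blast
  qed
qed

text \<open>
  Countably many closed balls cover the space. They are closed in the coarser topology as well, so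
  by Baire's theorem one of them has nonempty interior there.
\<close>

lemma small_open_set:
  assumes comp: "compact_space X" and haus: "Hausdorff_space X" and lsc: "norm_lsc X"
    and ne: "topspace X \<noteq> {}"
    and D: "countable D" "D \<subseteq> topspace X" "\<And>x. x \<in> topspace X \<Longrightarrow> \<exists>d\<in>D. norm (x - d) \<le> e"
  obtains U where "openin X U" "U \<noteq> {}" "\<And>x y. x \<in> U \<Longrightarrow> y \<in> U \<Longrightarrow> norm (x - y) \<le> 2 * e"
proof -
  define B where "B d = {x \<in> topspace X. norm (x - d) \<le> e}" for d
  have "\<Union>(B ` D) = topspace X" using D by (auto simp: B_def)
  then have "X interior_of \<Union>(B ` D) \<noteq> {}" using ne by simp
  moreover have "locally_compact_space X \<and> regular_space X"
    using comp haus by (simp add: compact_Hausdorff_imp_regular_space compact_imp_locally_compact_space)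
  moreover have "closedin X (B d)" if "d \<in> D" for d
    unfolding B_def using norm_lsc_closed_ball[OF lsc] that D by blast
  ultimately obtain d where "d \<in> D" and ne': "X interior_of B d \<noteq> {}"
    using Baire_category_alt[of X "B ` D"] \<open>countable D\<close> by (metis (no_types, lifting) countable_image imageE)
  have "norm (x - y) \<le> 2 * e" if "x \<in> X interior_of B d" "y \<in> X interior_of B d" for x y
  proof -
    have "norm (x - d) \<le> e" "norm (y - d) \<le> e"
      using that interior_of_subset unfolding B_def by fastforce+
    then show ?thesis
      using norm_triangle_ineq4[of "x - d" "y - d"] by simp
  qed
  then show thesis using that[of "X interior_of B d"] ne' by simp
qed

section \<open>Minimal norm-distal flows\<close>

definition minimal_flow :: "'q topology \<Rightarrow> ('s \<Rightarrow> 'q \<Rightarrow> 'q) \<Rightarrow> bool" where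
  "minimal_flow X act \<longleftrightarrow>
     (\<forall>N. closedin X N \<and> N \<noteq> {} \<and> (\<forall>s. act s ` N \<subseteq> N) \<longrightarrow> N = topspace X)"

text \<open>The closure of an orbit is closed and invariant, so in a minimal flow every orbit is dense.\<close>

lemma minimal_flow_orbit_meets_open:
  assumes dyn: "dynamical_system X act" and min: "minimal_flow X act"
    and "openin X U" "U \<noteq> {}" "x \<in> topspace X"
  obtains s where "act s x \<in> U"
proof -
  let ?N = "X closure_of range (\<lambda>s. act s x)"
  have cont: "continuous_map X X (act s)" for s using dyn by (simp add: dynamical_system_def)
  have orbit: "range (\<lambda>s. act s x) \<subseteq> topspace X"
    using cont \<open>x \<in> topspace X\<close> by (auto simp: continuous_map_def)
  have "act s ` ?N \<subseteq> ?N" for s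
  proof -
    have "act s ` range (\<lambda>s. act s x) \<subseteq> range (\<lambda>s. act s x)"
    proof clarify
      fix t
      have "act s (act t x) = act (s * t) x"
        using dyn \<open>x \<in> topspace X\<close> by (simp add: dynamical_system_def)
      then show "act s (act t x) \<in> range (\<lambda>s. act s x)" by simp
    qed
    then show ?thesis
      using continuous_map_image_closure_subset[OF cont] closure_of_mono by blast
  qed
  moreover have "?N \<noteq> {}"
    using closure_of_subset[OF orbit] by blast
  ultimately have "?N = topspace X" using min by (simp add: minimal_flow_def)
  moreover obtain z where z: "z \<in> U" using \<open>U \<noteq> {}\<close> by blast
  ultimately have "z \<in> ?N" using openin_subset[OF \<open>openin X U\<close>] by blast
  then obtain y where "y \<in> range (\<lambda>s. act s x)" "y \<in> U"
    using z \<open>openin X U\<close> unfolding in_closure_of by blast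
  then show thesis using that by blast
qed

text \<open>
  Suppose that the pair \<open>(x, y)\<close> can be moved arbitrarily close to \<open>(w, w)\<close>. Some \<open>s\<close> moves \<open>w\<close> into an
  open set \<open>U\<close> of small norm diameter, so it moves a whole neighbourhood of \<open>w\<close> into \<open>U\<close>. First moving
  \<open>x\<close> and \<open>y\<close> into this neighbourhood and then applying \<open>s\<close> brings them norm close to each other.
\<close>

lemma norm_distal_imp_distal:
  assumes dyn: "dynamical_system X act" and min: "minimal_flow X act"
    and small: "\<forall>e>0. \<exists>U. openin X U \<and> U \<noteq> {} \<and> (\<forall>x\<in>U. \<forall>y\<in>U. norm (x - y) < e)"
    and distal: "norm_distal (topspace X) act"
    and xy: "x \<in> topspace X" "y \<in> topspace X" and w: "(w, w) \<in> pair_orbit_closure X act x y"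
  shows "x = y"
proof (rule ccontr)
  assume "x \<noteq> y"
  have "0 \<in> closure {act s x - act s y |s. True}"
    unfolding closure_approachable
  proof (intro allI impI)
    fix e :: real assume "e > 0"
    then obtain U where U: "openin X U" "U \<noteq> {}" and Ue: "\<forall>x\<in>U. \<forall>y\<in>U. norm (x - y) < e"
      using small by meson
    have "w \<in> topspace X" using w by (auto simp: pair_orbit_closure_def in_closure_of)
    then obtain s where s: "act s w \<in> U"
      using minimal_flow_orbit_meets_open[OF dyn min U] by blast
    define V where "V = {v \<in> topspace X. act s v \<in> U}"
    have "openin X V"
      unfolding V_def using dyn U by (auto simp: dynamical_system_def intro: openin_continuous_map_preimage)
    then have "openin (prod_topology X X) (V \<times> V)" by (simp add: openin_prod_Times_iff)
    moreover have "(w, w) \<in> V \<times> V" using s \<open>w \<in> topspace X\<close> by (simp add: V_def)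
    ultimately obtain p where "p \<in> range (\<lambda>s. (act s x, act s y))" "p \<in> V \<times> V"
      using w unfolding pair_orbit_closure_def in_closure_of by meson
    then obtain t where t: "act t x \<in> V" "act t y \<in> V" by auto
    then have "norm (act (s * t) x - act (s * t) y) < e"
      using dyn xy Ue by (simp add: dynamical_system_def V_def)
    then show "\<exists>z\<in>{act s x - act s y |s. True}. dist z 0 < e" by auto
  qed
  then show False using distal xy \<open>x \<noteq> y\<close> by (auto simp: norm_distal_def)
qed

lemma enveloping_semigroup_nonexpansive:
  assumes lsc: "norm_lsc X" and dyn: "dynamical_system X act"
    and ne: "nonexpansive_action (topspace X) act"
    and "f \<in> enveloping_semigroup X act" "x \<in> topspace X" "y \<in> topspace X"
  shows "norm (f x - f y) \<le> norm (x - y)"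
proof -
  let ?R = "{(u, v) \<in> topspace X \<times> topspace X. norm (u - v) \<le> norm (x - y)}"
  have "act s x \<in> topspace X" "act s y \<in> topspace X" for s
    using dyn assms(5,6) by (auto simp: dynamical_system_def continuous_map_def)
  then have "range (\<lambda>s. (act s x, act s y)) \<subseteq> ?R"
    using ne assms(5,6) by (auto simp: nonexpansive_action_def)
  then have "pair_orbit_closure X act x y \<subseteq> ?R"
    unfolding pair_orbit_closure_def using lsc by (intro closure_of_minimal) (auto simp: norm_lsc_def)
  then show ?thesis using enveloping_semigroup_pair[OF assms(4-6)] by blast
qed

text \<open>The inverse of \<open>s\<close> provided by \<open>distal_flow_invertible\<close> is a pointwise limit of nonexpansive
  maps and hence nonexpansive, so \<open>s\<close> cannot shrink any distance.\<close>

lemma minimal_flow_isometric_bijections: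
  assumes dyn: "dynamical_system X act" and comp: "compact_space X" and haus: "Hausdorff_space X"
    and lsc: "norm_lsc X" and min: "minimal_flow X act"
    and small: "\<forall>e>0. \<exists>U. openin X U \<and> U \<noteq> {} \<and> (\<forall>x\<in>U. \<forall>y\<in>U. norm (x - y) < e)"
    and ne: "nonexpansive_action (topspace X) act" and distal: "norm_distal (topspace X) act"
  shows "act s ` topspace X = topspace X"
    and "\<And>x y. x \<in> topspace X \<Longrightarrow> y \<in> topspace X \<Longrightarrow> norm (act s x - act s y) = norm (x - y)"
proof -
  obtain f where f: "f \<in> enveloping_semigroup X act"
    and sf: "\<And>x. x \<in> topspace X \<Longrightarrow> act s (f x) = x"
    and fs: "\<And>x. x \<in> topspace X \<Longrightarrow> f (act s x) = x"
    using distal_flow_invertible[OF dyn comp haus, of s]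
      norm_distal_imp_distal[OF dyn min small distal] by blast
  have s: "act s x \<in> topspace X" if "x \<in> topspace X" for x
    using dyn that by (auto simp: dynamical_system_def continuous_map_def)
  have fX: "f x \<in> topspace X" if "x \<in> topspace X" for x
    using enveloping_semigroup_PiE[OF f] that by blast
  show "act s ` topspace X = topspace X"
    using s sf fX by (metis image_eqI image_subsetI subsetI subset_antisym)
  fix x y assume xy: "x \<in> topspace X" "y \<in> topspace X"
  have "norm (x - y) \<le> norm (act s x - act s y)"
    using enveloping_semigroup_nonexpansive[OF lsc dyn ne f s[OF xy(1)] s[OF xy(2)]] fs xy by simp
  then show "norm (act s x - act s y) = norm (x - y)"
    using ne xy by (simp add: nonexpansive_action_def order_antisym)
qed

text \<open>
  The preimages of \<open>U\<close> form an open cover, since every orbit meets \<open>U\<close>. By isometry they are as small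
  as \<open>U\<close> itself, and one point from each member of a finite subcover gives the net.
\<close>

lemma minimal_isometric_flow_finite_net:
  assumes dyn: "dynamical_system X act" and comp: "compact_space X" and min: "minimal_flow X act"
    and U: "openin X U" "U \<noteq> {}" "\<And>x y. x \<in> U \<Longrightarrow> y \<in> U \<Longrightarrow> norm (x - y) \<le> e"
    and iso: "\<And>s x y. x \<in> topspace X \<Longrightarrow> y \<in> topspace X \<Longrightarrow> norm (act s x - act s y) = norm (x - y)"
  obtains F where "finite F" "F \<subseteq> topspace X" "\<And>x. x \<in> topspace X \<Longrightarrow> \<exists>d\<in>F. norm (x - d) \<le> e"
proof -
  define V where "V s = {v \<in> topspace X. act s v \<in> U}" for s
  have "openin X (V s)" for s
    unfolding V_def using dyn U by (auto simp: dynamical_system_def intro: openin_continuous_map_preimage)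
  moreover have "topspace X \<subseteq> (\<Union>s. V s)"
    using minimal_flow_orbit_meets_open[OF dyn min U(1,2)] unfolding V_def by blast
  ultimately obtain \<F> where \<F>: "finite \<F>" "\<F> \<subseteq> range V" "topspace X \<subseteq> \<Union>\<F>"
    using comp unfolding compact_space_alt by (metis (no_types, lifting) image_iff)
  then obtain I where I: "finite I" "\<F> = V ` I" by (meson finite_subset_image)
  define J where "J = {s \<in> I. V s \<noteq> {}}"
  define c where "c s = (SOME v. v \<in> V s)" for s
  have c: "c s \<in> V s" if "s \<in> J" for s
    using that by (auto simp: J_def c_def intro: someI_ex)
  show thesis
  proof
    show "finite (c ` J)" using I by (simp add: J_def)
    show "c ` J \<subseteq> topspace X" using c by (auto simp: V_def)
    fix x assume x: "x \<in> topspace X"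
    then have "x \<in> \<Union>(V ` I)" using \<F>(3) I(2) by blast
    then obtain s where s: "s \<in> J" "x \<in> V s" unfolding J_def by blast
    then have "norm (act s x - act s (c s)) \<le> e" using U c by (auto simp: V_def)
    then have "norm (x - c s) \<le> e" using iso x c s by (simp add: V_def)
    then show "\<exists>d\<in>c ` J. norm (x - d) \<le> e" using s by blast
  qed
qed

section \<open>Centres of totally bounded sets\<close>

text \<open>
  Let \<open>\<delta>\<close> be the diameter of \<open>M\<close> and \<open>u\<close> the average of a finite net of \<open>n\<close> points with mesh \<open>\<delta> / 2\<close>. Each
  \<open>m \<in> M\<close> has distance at most \<open>\<delta>\<close> from all points of the net and at most \<open>\<delta> / 2\<close> from one of them,
  so averaging gives \<open>norm (u - m) \<le> \<delta> - \<delta> / (2 * n)\<close>.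
\<close>

lemma better_than_diameter_centre:
  fixes M :: "'b::real_normed_vector set"
  assumes net: "\<And>e. e > 0 \<Longrightarrow> \<exists>F. finite F \<and> F \<subseteq> M \<and> (\<forall>x\<in>M. \<exists>d\<in>F. norm (x - d) \<le> e)"
    and ab: "a \<in> M" "b \<in> M" "a \<noteq> b"
  obtains u r where "u \<in> convex hull M" "\<And>m. m \<in> M \<Longrightarrow> norm (u - m) \<le> r"
    "\<exists>x\<in>M. \<exists>y\<in>M. r < norm (x - y)"
proof -
  have bdd: "bounded M"
  proof -
    obtain F where F: "finite F" "\<forall>x\<in>M. \<exists>d\<in>F. norm (x - d) \<le> 1" using net[of 1] by auto
    have "M \<subseteq> (\<Union>d\<in>F. cball d 1)" using F(2) by (auto simp: dist_norm norm_minus_commute)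
    then show ?thesis using F(1) by (meson bounded_UN bounded_cball bounded_subset)
  qed
  let ?D = "diameter M"
  have D: "norm (x - y) \<le> ?D" if "x \<in> M" "y \<in> M" for x y
    using diameter_bounded_bound[OF bdd that] by (simp add: dist_norm)
  have "?D > 0" using D[OF ab(1,2)] ab(3) by (smt (verit) zero_less_norm_iff right_minus_eq)
  then obtain F where F: "finite F" "F \<subseteq> M" and cover: "\<forall>x\<in>M. \<exists>d\<in>F. norm (x - d) \<le> ?D / 2"
    using net[of "?D / 2"] by auto
  have "F \<noteq> {}" using cover ab by blast
  define n where "n = real (card F)"
  have n: "n \<ge> 1" using F \<open>F \<noteq> {}\<close> by (simp add: n_def Suc_leI card_gt_0_iff)
  define u where "u = (\<Sum>d\<in>F. (1 / n) *\<^sub>R d)"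
  define r where "r = ?D - ?D / (2 * n)"
  have "u \<in> convex hull M"
    unfolding u_def
  proof (rule convex_sum)
    show "(\<Sum>d\<in>F. 1 / n) = 1" using n by (simp add: n_def)
    show "d \<in> convex hull M" if "d \<in> F" for d using that F hull_subset by fast
  qed (use F n in auto)
  moreover have "norm (u - m) \<le> r" if "m \<in> M" for m
  proof -
    obtain d where d: "d \<in> F" "norm (d - m) \<le> ?D / 2" using cover \<open>m \<in> M\<close> norm_minus_commute by metis
    have "m = (\<Sum>d\<in>F. (1 / n) *\<^sub>R m)"
      using n by (simp add: n_def sum_constant_scaleR)
    then have "u - m = (\<Sum>d\<in>F. (1 / n) *\<^sub>R (d - m))"
      by (simp add: u_def scaleR_diff_right sum_subtractf)
    also have "\<dots> = (1 / n) *\<^sub>R (d - m) + (\<Sum>d\<in>F - {d}. (1 / n) *\<^sub>R (d - m))"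
      using F d by (simp add: sum.remove)
    also have "norm \<dots> \<le> (1 / n) * norm (d - m) + (\<Sum>d\<in>F - {d}. (1 / n) * norm (d - m))"
      using n by (intro order_trans[OF norm_triangle_ineq] add_mono order_trans[OF norm_sum]) auto
    also have "\<dots> \<le> (1 / n) * (?D / 2) + (\<Sum>d\<in>F - {d}. (1 / n) * ?D)"
      using n d F that D by (intro add_mono sum_mono mult_left_mono) auto
    also have "\<dots> = (1 / n) * (?D / 2) + (n - 1) * ((1 / n) * ?D)"
      using d F n by (simp add: n_def of_nat_diff)
    also have "\<dots> = r" using n by (simp add: r_def field_simps)
    finally show ?thesis .
  qed
  moreover have "\<exists>x\<in>M. \<exists>y\<in>M. r < norm (x - y)"
  proof (rule ccontr)
    assume "\<not> ?thesis"
    then have "?D \<le> r" using ab by (intro diameter_le) (auto simp: not_less)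
    moreover have "r < ?D" using n \<open>?D > 0\<close> by (simp add: r_def)
    ultimately show False by simp
  qed
  ultimately show thesis using that by blast
qed

section \<open>The fixed point\<close>

theorem corollary3p3:
  fixes Q :: "('a::banach \<Rightarrow>\<^sub>L real) set"
    and act :: "'s::semigroup_mult \<Rightarrow> ('a \<Rightarrow>\<^sub>L real) \<Rightarrow> ('a \<Rightarrow>\<^sub>L real)"
  assumes "Q \<noteq> {}"
    and "separable_space (subtopology euclidean Q)"
    and "compactin weak_star_topology Q"
    and "convex Q"
    and "dynamical_system (subtopology weak_star_topology Q) act"
    and "nonexpansive_action Q act"
    and "norm_distal Q act"
  shows "\<exists>x\<in>Q. \<forall>s. act s x = x"
proof -
  let ?X = "subtopology weak_star_topology Q"
  have top: "topspace ?X = Q" by (simp add: strong_operator_topology_topspace)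
  have comp: "compact_space ?X" using assms(3) by (rule compact_space_subtopology)
  have haus: "Hausdorff_space ?X" by (intro Hausdorff_space_subtopology weak_star_Hausdorff)
  have lsc: "norm_lsc ?X" by (intro norm_lsc_subtopology weak_star_norm_lsc)
  have inv: "act s ` Q \<subseteq> Q" for s
    using assms(5) top by (auto simp: dynamical_system_def continuous_map_def)
  obtain K where K: "closedin ?X K" "K \<noteq> {}" "convex K" "\<And>s. act s ` K \<subseteq> K"
    and Kmin: "\<And>N. closedin ?X N \<Longrightarrow> N \<noteq> {} \<Longrightarrow> convex N \<Longrightarrow> (\<And>s. act s ` N \<subseteq> N) \<Longrightarrow> N \<subseteq> K \<Longrightarrow> N = K"
  proof (rule minimal_closed_subset[of ?X Q "\<lambda>B. convex B \<and> (\<forall>s. act s ` B \<subseteq> B)"])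
    show "closedin ?X Q" using closedin_topspace[of ?X] unfolding top .
    show "convex (\<Inter>\<C>) \<and> (\<forall>s. act s ` \<Inter>\<C> \<subseteq> \<Inter>\<C>)"
      if "\<And>B. B \<in> \<C> \<Longrightarrow> convex B \<and> (\<forall>s. act s ` B \<subseteq> B)" for \<C>
      using that by (blast intro: convex_Inter)
  qed (use assms(1,4) comp inv in auto)
  obtain M where M: "closedin ?X M" "M \<noteq> {}" "\<And>s. act s ` M \<subseteq> M" "M \<subseteq> K"
    and Mmin: "\<And>N. closedin ?X N \<Longrightarrow> N \<noteq> {} \<Longrightarrow> (\<And>s. act s ` N \<subseteq> N) \<Longrightarrow> N \<subseteq> M \<Longrightarrow> N = M"
  proof (rule minimal_closed_subset[of ?X K "\<lambda>B. \<forall>s. act s ` B \<subseteq> B"])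
    show "\<forall>s. act s ` \<Inter>\<C> \<subseteq> \<Inter>\<C>" if "\<And>B. B \<in> \<C> \<Longrightarrow> \<forall>s. act s ` B \<subseteq> B" for \<C>
      using that by blast
  qed (use K comp in auto)
  have KQ: "K \<subseteq> Q" using K(1) closedin_subset top by metis
  then have MQ: "M \<subseteq> Q" using M by blast
  let ?Y = "subtopology ?X M"
  have topY: "topspace ?Y = M" using MQ top by auto
  have dyn: "dynamical_system ?Y act"
    unfolding dynamical_system_def topY
  proof (intro conjI allI ballI)
    show "continuous_map ?Y ?Y (act s)" for s
      using assms(5) M(3) unfolding continuous_map_in_subtopology dynamical_system_def
      by (metis continuous_map_from_subtopology continuous_map_in_subtopology topY image_subset_iff_funcset)
    show "act (s * t) x = act s (act t x)" if "x \<in> M" for s t x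
      using assms(5) that MQ top by (auto simp: dynamical_system_def)
  qed
  have min: "minimal_flow ?Y act"
    unfolding minimal_flow_def topY
    using Mmin M(1) by (metis closedin_closed_subtopology)
  have compY: "compact_space ?Y"
    using M(1) comp closedin_compact_space compact_space_subtopology by blast
  have hausY: "Hausdorff_space ?Y" using haus by (rule Hausdorff_space_subtopology)
  have lscY: "norm_lsc ?Y" using lsc by (rule norm_lsc_subtopology)
  have small: "\<forall>e>0. \<exists>U. openin ?Y U \<and> U \<noteq> {} \<and> (\<forall>x\<in>U. \<forall>y\<in>U. norm (x - y) < e)"
  proof (intro allI impI)
    fix e :: real assume "e > 0"
    obtain D where D: "countable D" "D \<subseteq> M" "\<And>x. x \<in> M \<Longrightarrow> \<exists>d\<in>D. norm (x - d) \<le> e / 3"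
      using separable_countable_net[OF assms(2) MQ, of "e / 3"] \<open>e > 0\<close> by auto
    obtain U where "openin ?Y U" "U \<noteq> {}" "\<And>x y. x \<in> U \<Longrightarrow> y \<in> U \<Longrightarrow> norm (x - y) \<le> 2 * (e / 3)"
      using small_open_set[OF compY hausY lscY _ D(1)] D M(2) unfolding topY by metis
    moreover have "2 * (e / 3) < e" using \<open>e > 0\<close> by simp
    ultimately show "\<exists>U. openin ?Y U \<and> U \<noteq> {} \<and> (\<forall>x\<in>U. \<forall>y\<in>U. norm (x - y) < e)"
      by (meson le_less_trans)
  qed
  have neY: "nonexpansive_action (topspace ?Y) act"
    using assms(6) MQ unfolding topY nonexpansive_action_def by blast
  have distalY: "norm_distal (topspace ?Y) act"
    using assms(7) MQ unfolding topY norm_distal_def by blast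
  note bij = minimal_flow_isometric_bijections[OF dyn compY hausY lscY min small neY distalY]
  have net: "\<exists>F. finite F \<and> F \<subseteq> M \<and> (\<forall>x\<in>M. \<exists>d\<in>F. norm (x - d) \<le> e)" if "e > 0" for e
  proof -
    obtain U where "openin ?Y U" "U \<noteq> {}" "\<And>x y. x \<in> U \<Longrightarrow> y \<in> U \<Longrightarrow> norm (x - y) \<le> e"
      using small \<open>e > 0\<close> less_imp_le by metis
    from minimal_isometric_flow_finite_net[OF dyn compY min this bij(2)] show ?thesis
      unfolding topY by metis
  qed
  obtain a where "a \<in> M" using M by blast
  have "M = {a}"
  proof (rule ccontr)
    assume "M \<noteq> {a}"
    then obtain b where "b \<in> M" "a \<noteq> b" using \<open>a \<in> M\<close> by blast
    then obtain u r x y where u: "u \<in> convex hull M" "\<And>m. m \<in> M \<Longrightarrow> norm (u - m) \<le> r"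
      and xy: "x \<in> M" "y \<in> M" "r < norm (x - y)"
      using better_than_diameter_centre[OF net \<open>a \<in> M\<close>] by metis
    \<comment> \<open>DeMarr's set. It is written with balls relative to \<open>Q\<close> to be weak-star closed in \<open>Q\<close>, and
      with full norm balls for convexity.\<close>
    define C where "C = K \<inter> (\<Inter>m\<in>M. {z \<in> topspace ?X. norm (z - m) \<le> r})"
    have Ceq: "C = K \<inter> (\<Inter>m\<in>M. cball m r)"
      using KQ unfolding C_def top by (auto simp: dist_norm norm_minus_commute)
    have "C = K"
    proof (rule Kmin)
      show "closedin ?X C"
        unfolding C_def using K(1) M(2) MQ top
        by (intro closedin_Int closedin_INT norm_lsc_closed_ball[OF lsc]) auto
      have "u \<in> K" using u(1) hull_minimal[of M K convex] M(4) K(3) by blast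
      then show "C \<noteq> {}"
        unfolding Ceq using u(2) by (auto simp: dist_norm norm_minus_commute)
      show "convex C" unfolding Ceq using K(3) by (intro convex_Int convex_INT) auto
      show "act s ` C \<subseteq> C" for s
      proof clarify
        fix z assume z: "z \<in> C"
        then have zK: "z \<in> K" by (simp add: Ceq)
        have "norm (act s z - m) \<le> r" if "m \<in> M" for m
        proof -
          \<comment> \<open>Surjectivity on \<open>M\<close> is essential here: nonexpansiveness only controls the distance to
            points of the form \<open>act s m'\<close>.\<close>
          obtain m' where m': "m' \<in> M" "m = act s m'" using bij(1) \<open>m \<in> M\<close> unfolding topY by blast
          then have "norm (act s z - m) \<le> norm (z - m')"
            using assms(6) zK KQ MQ by (simp add: nonexpansive_action_def subset_iff)
          also have "\<dots> \<le> r" using z m' by (auto simp: C_def)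
          finally show ?thesis .
        qed
        then show "act s z \<in> C"
          using K(4) zK unfolding Ceq by (auto simp: dist_norm norm_minus_commute)
      qed
    qed (auto simp: Ceq)
    then have "norm (x - y) \<le> r" using xy(1,2) M(4) unfolding C_def by blast
    then show False using xy(3) by simp
  qed
  then show ?thesis using M(3) MQ by auto
qed

end
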